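(* Let $\mathcal{V}$ be the real vector space of planted decorated trees and monomials $X_0,\dots,X_d$, with the Lie bracket $[\cdot,\cdot]_1$ and the products $\widehat{\triangleright}$ and $\triangleright$ defined in the context. Then the post-Lie algebra $(\mathcal{V},[\cdot,\cdot]_1,\widehat{\triangleright})$ is a post-Lie deformation of the pre-Lie algebra $(\mathcal{V},[\cdot,\cdot]_0=0,\triangleright)$.
   Context: **Post-Lie algebras and deformations.** A post-Lie algebra $(\mathfrak{g},[\cdot,\cdot],\triangleright)$ is a Lie algebra $(\mathfrak{g},[\cdot,\cdot])$ with a bilinear product $\triangleright$ such that $x\triangleright[y,z]=[x\triangleright y,z]+[y,x\triangleright z]$ and $([x,y]+x\triangleright y-y\triangleright x)\triangleright z=x\triangleright(y\triangleright z)-y\triangleright(x\triangleright z)$. A pre-Lie algebra is a post-Lie algebra with zero bracket. A post-Lie deformation of a pre-Lie algebra $(\mathfrak{g},\triangleright)$ is a post-Lie algebra of the form $(\mathfrak{g},\pi,\triangleright+\omega)$ with linear maps $\pi\in\mathrm{Hom}(\wedge^2\mathfrak{g},\mathfrak{g})$, $\omega\in\mathrm{Hom}(\mathfrak{g}\otimes\mathfrak{g},\mathfrak{g})$. **Decorated trees.** Fix $d\ge0$; $\mathbb{N}$ contains $0$; $e_0,\dots,e_d$ is the standard basis of $\mathbb{N}^{d+1}$. A decorated tree is a (isomorphism class of) non-planar rooted tree $T$ with node set $N_T$ and edge set $E_T$, node decorations $\mathfrak{n}:N_T\to\mathbb{N}^{d+1}$ and edge decorations in $\{I,\Xi\}\times\mathbb{N}^{d+1}$.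 Edges of type $\Xi$ ("noise edges") are only decorated by $(\Xi,0)$, are terminal (their upper end is a leaf), have node decoration $0$ at that leaf, and at most one of them is attached to each node; all other edges are decorated by some $(I,a)$, $a\in\mathbb{N}^{d+1}$. Let $\mathfrak{T}$ be the set of decorated trees. $I_a(\tau)$ is the planted tree obtained by grafting the root of $\tau$ onto a new root, decorated by $0$, via a new edge decorated by $(I,a)$. $X_i$ is the single node decorated by $e_i$. Let $\mathcal{V}$ be the real vector space with basis $\{I_a(\tau):a\in\mathbb{N}^{d+1},\tau\in\mathfrak{T}\}\cup\{X_0,\dots,X_d\}$. **Operations.** In all sums over nodes below, leaves of noise edges are excluded (such terms are zero). For a node $w$ of $\tau$: $\sigma\curvearrowright^a_w\tau$ is the tree obtained by attaching the root of $\sigma$ to $w$ by a new edge decorated by $(I,a)$; $\uparrow_w^{m}\tau$ adds $m\in\mathbb{Z}^{d+1}$ to the decoration of $w$. Set $$\sigma\curvearrowright^a\tau=\sum_{w\in N_\tau}\sigma\curvearrowright^a_w\tau,\quad \sigma\,\widehat{\curvearrowright}^a\tau=\sum_{w\in N_\tau}\sum_{\ell\in\mathbb{N}^{d+1}}\binom{\mathfrak{n}_w}{\ell}\,\sigma\curvearrowright_w^{a-\ell}(\uparrow_w^{-\ell}\tau),\quad \uparrow^i\tau=\sum_{w\in N_\tau}\uparrow_w^{e_i}\tau,$$ where $\mathfrak{n}_w$ is the decoration of $w$, binomials of multi-indices are products of componentwise binomials, and terms in which $a-\ell$ or $\mathfrak{n}_w-\ell$ is not in $\mathbb{N}^{d+1}$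 are zero. **Structures on $\mathcal{V}$.** The Lie bracket $[\cdot,\cdot]_1$ is zero on two planted trees, zero on two elements of $\mathrm{span}(X_0,\dots,X_d)$, and $[I_a(\tau),X_i]_1=I_{a-e_i}(\tau)$ ($=0$ if $a-e_i\notin\mathbb{N}^{d+1}$). The product $\widehat{\triangleright}$ is given by $X_i\,\widehat{\triangleright}\,I_a(\tau)=I_a(\uparrow^i\tau)$, $I_a(\tau)\,\widehat{\triangleright}\,X_i=0$, $X_i\,\widehat{\triangleright}\,X_j=0$, $I_a(\sigma)\,\widehat{\triangleright}\,I_b(\tau)=I_b(\sigma\,\widehat{\curvearrowright}^a\tau)$. The product $\triangleright$ is given by $X_i\triangleright I_a(\tau)=I_a(\uparrow^i\tau)$, $I_a(\tau)\triangleright X_i=0$, $X_i\triangleright X_j=0$, $I_a(\sigma)\triangleright I_b(\tau)=I_b(\sigma\curvearrowright^a\tau)$. It is a known theorem (Bruned–Katsetsiadis) that $(\mathcal{V},[\cdot,\cdot]_1,\widehat{\triangleright})$ is a post-Lie algebra; and $(\mathcal{V},\triangleright)$ is a pre-Lie algebra. *)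

theory Defs
  imports "HOL-Analysis.Analysis" "HOL-Analysis.Finite_Function_Topology" "HOL-Library.Multiset"
begin

section \<open>Post-Lie algebras and deformations\<close>

text \<open>The algebras live on a linear subspace of an ambient real vector space; the operations
  are only constrained on that subspace.\<close>

definition bilinear_on :: "'v::real_vector set \<Rightarrow> ('v \<Rightarrow> 'v \<Rightarrow> 'v) \<Rightarrow> bool" where
  "bilinear_on \<gg> f \<longleftrightarrow>
     (\<forall>x\<in>\<gg>. \<forall>y\<in>\<gg>. f x y \<in> \<gg>) \<and>
     (\<forall>x\<in>\<gg>. \<forall>x'\<in>\<gg>. \<forall>y\<in>\<gg>. f (x + x') y = f x y + f x' y) \<and>
     (\<forall>x\<in>\<gg>. \<forall>y\<in>\<gg>. \<forall>y'\<in>\<gg>. f x (y + y') = f x y + f x y') \<and>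
     (\<forall>c. \<forall>x\<in>\<gg>. \<forall>y\<in>\<gg>. f (c *\<^sub>R x) y = c *\<^sub>R f x y) \<and>
     (\<forall>c. \<forall>x\<in>\<gg>. \<forall>y\<in>\<gg>. f x (c *\<^sub>R y) = c *\<^sub>R f x y)"

definition alternating_on :: "'v::real_vector set \<Rightarrow> ('v \<Rightarrow> 'v \<Rightarrow> 'v) \<Rightarrow> bool" where
  "alternating_on \<gg> f \<longleftrightarrow> (\<forall>x\<in>\<gg>. f x x = 0)"

locale lie_algebra =
  fixes \<gg> :: "'v::real_vector set" and br :: "'v \<Rightarrow> 'v \<Rightarrow> 'v"
  assumes subspace: "subspace \<gg>"
    and bilinear_br: "bilinear_on \<gg> br"
    and alternating_br: "alternating_on \<gg> br"
    and jacobi: "\<lbrakk>x \<in> \<gg>; y \<in> \<gg>; z \<in> \<gg>\<rbrakk> \<Longrightarrow> br x (br y z) + br y (br z x) + br z (br x y) = 0"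

locale post_lie_algebra = lie_algebra \<gg> br
  for \<gg> :: "'v::real_vector set" and br :: "'v \<Rightarrow> 'v \<Rightarrow> 'v" +
  fixes tr :: "'v \<Rightarrow> 'v \<Rightarrow> 'v"
  assumes bilinear_tr: "bilinear_on \<gg> tr"
    and derivation: "\<lbrakk>x \<in> \<gg>; y \<in> \<gg>; z \<in> \<gg>\<rbrakk> \<Longrightarrow>
      tr x (br y z) = br (tr x y) z + br y (tr x z)"
    and action: "\<lbrakk>x \<in> \<gg>; y \<in> \<gg>; z \<in> \<gg>\<rbrakk> \<Longrightarrow>
      tr (br x y + tr x y - tr y x) z = tr x (tr y z) - tr y (tr x z)"

definition pre_lie_algebra :: "'v::real_vector set \<Rightarrow> ('v \<Rightarrow> 'v \<Rightarrow> 'v) \<Rightarrow> bool" where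
  "pre_lie_algebra \<gg> tr \<longleftrightarrow> post_lie_algebra \<gg> (\<lambda>_ _. 0) tr"

text \<open>\<open>post_lie_deformation \<gg> tr br' tr'\<close>: the post-Lie algebra \<open>(\<gg>, br', tr')\<close> is a
  deformation of the pre-Lie algebra \<open>(\<gg>, tr)\<close>.\<close>

definition post_lie_deformation ::
  "'v::real_vector set \<Rightarrow> ('v \<Rightarrow> 'v \<Rightarrow> 'v) \<Rightarrow> ('v \<Rightarrow> 'v \<Rightarrow> 'v) \<Rightarrow> ('v \<Rightarrow> 'v \<Rightarrow> 'v) \<Rightarrow> bool" where
  "post_lie_deformation \<gg> tr br' tr' \<longleftrightarrow>
     pre_lie_algebra \<gg> tr \<and>
     post_lie_algebra \<gg> br' tr' \<and>
     (\<exists>\<pi> \<omega>. bilinear_on \<gg> \<pi> \<and> alternating_on \<gg> \<pi> \<and> bilinear_on \<gg> \<omega> \<and>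
        (\<forall>x\<in>\<gg>. \<forall>y\<in>\<gg>. br' x y = \<pi> x y \<and> tr' x y = tr x y + \<omega> x y))"


section \<open>Decorated trees\<close>

text \<open>The finite index type \<open>'i\<close> plays the role of \<open>{0,\<dots>,d}\<close>, so \<open>CARD('i) = d + 1\<close>, and
  \<open>axis i 1\<close> is the basis vector \<open>e\<^sub>i\<close>.  Isomorphism classes of non-planar trees are represented
  by unordered (multiset) branching; a branch is an edge decoration with the subtree above it.\<close>

type_synonym 'i multi_index = "nat ^ 'i"

datatype edge_type = I_edge | Xi_edge

type_synonym 'i edge_dec = "edge_type \<times> 'i multi_index"

datatype 'i::finite tree =
  Node (root_dec: "'i multi_index") (branches: "('i edge_dec \<times> 'i tree) multiset")

inductive decorated :: "'i::finite tree \<Rightarrow> bool" where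
  "\<lbrakk>\<And>a t. ((I_edge, a), t) \<in># F \<Longrightarrow> decorated t;
    \<And>a t. ((Xi_edge, a), t) \<in># F \<Longrightarrow> a = 0 \<and> t = Node 0 {#};
    size {#b \<in># F. fst (fst b) = Xi_edge#} \<le> 1\<rbrakk>
   \<Longrightarrow> decorated (Node n F)"

text \<open>As nodes of an isomorphism class have no names, a node \<open>w\<close> of \<open>\<tau>\<close> is represented by a
  pointed tree \<open>(p, s)\<close>: \<open>s\<close> is the subtree above \<open>w\<close>, and \<open>p\<close> lists, along the path from the
  root of \<open>\<tau>\<close> to \<open>w\<close>, the node decoration, the branches not taken and the edge taken.  Forgetting
  the point gives back \<open>\<tau>\<close>.\<close>

type_synonym 'i path =
  "('i multi_index \<times> ('i edge_dec \<times> 'i tree) multiset \<times> 'i edge_dec) list"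

type_synonym 'i pointed = "'i path \<times> 'i tree"

primrec plug :: "'i::finite path \<Rightarrow> 'i tree \<Rightarrow> 'i tree" where
  "plug [] s = s"
| "plug (c # p) s = (case c of (n, G, e) \<Rightarrow> Node n (add_mset (e, plug p s) G))"

definition forget :: "'i::finite pointed \<Rightarrow> 'i tree" where
  "forget w = plug (fst w) (snd w)"

lemma size_branch_less:
  assumes "(e, t) \<in># F"
  shows "size t < size (Node n F)"
proof -
  obtain G where "F = add_mset (e, t) G"
    using assms by (metis multi_member_split)
  then show ?thesis
    by simp
qed

text \<open>The nodes of a tree, without the leaves of noise edges, and counted with multiplicity:
  nodes exchanged by an automorphism give the same pointed tree.\<close>

function nodes :: "'i::finite tree \<Rightarrow> 'i pointed multiset" where
  "nodes (Node n F) = add_mset ([], Node n F)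
     (\<Sum>(e, t)\<in>#F. if fst e = I_edge
        then image_mset (\<lambda>(p, s). ((n, F - {#(e, t)#}, e) # p, s)) (nodes t)
        else {#})"
  by pat_completeness auto
termination
  by (relation "inv_image less_than size") (auto intro: size_branch_less simp del: tree.size)

lemma forget_nodes: "w \<in># nodes \<tau> \<Longrightarrow> forget w = \<tau>"
proof (induction \<tau> arbitrary: w rule: nodes.induct)
  case (1 n F)
  show ?case
  proof (cases "w = ([], Node n F)")
    case True
    then show ?thesis
      by (simp add: forget_def)
  next
    case False
    with "1.prems" obtain b where b: "b \<in># F"
      "w \<in># (case b of (e, t) \<Rightarrow> if fst e = I_edge
         then image_mset (\<lambda>(p, s). ((n, F - {#(e, t)#}, e) # p, s)) (nodes t) else {#})"
      by auto
    obtain e t where "b = (e, t)"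
      by fastforce
    with b obtain p s where *: "(e, t) \<in># F" "fst e = I_edge" "(p, s) \<in># nodes t"
      "w = ((n, F - {#(e, t)#}, e) # p, s)"
      by (auto split: if_splits)
    then have "forget (p, s) = t"
      using "1.IH" by blast
    with * show ?thesis
      by (simp add: forget_def)
  qed
qed

definition node_dec :: "'i::finite pointed \<Rightarrow> nat^'i" where
  "node_dec w = root_dec (snd w)"

definition graft_at :: "nat^'i::finite \<Rightarrow> 'i tree \<Rightarrow> 'i pointed \<Rightarrow> 'i pointed" where
  "graft_at a \<sigma> w =
     (fst w, Node (root_dec (snd w)) (add_mset ((I_edge, a), \<sigma>) (branches (snd w))))"

definition raise_at :: "nat^'i::finite \<Rightarrow> 'i pointed \<Rightarrow> 'i pointed" where
  "raise_at m w = (fst w, Node (root_dec (snd w) + m) (branches (snd w)))"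

text \<open>Subtraction on \<open>nat\<close> truncates; \<open>lower_at\<close> is only used when \<open>m \<le> node_dec w\<close>.\<close>

definition lower_at :: "nat^'i::finite \<Rightarrow> 'i pointed \<Rightarrow> 'i pointed" where
  "lower_at m w = (fst w, Node (root_dec (snd w) - m) (branches (snd w)))"

section \<open>Operations on linear combinations of trees\<close>

definition basis_vec :: "'b \<Rightarrow> 'b \<Rightarrow>\<^sub>0 real" where
  "basis_vec b = Poly_Mapping.single b 1"

definition lin_ext :: "('b \<Rightarrow> 'v::real_vector) \<Rightarrow> ('b \<Rightarrow>\<^sub>0 real) \<Rightarrow> 'v" where
  "lin_ext f u = (\<Sum>b\<in>Poly_Mapping.keys u. Poly_Mapping.lookup u b *\<^sub>R f b)"

definition bilin_ext ::
  "('b \<Rightarrow> 'c \<Rightarrow> 'v::real_vector) \<Rightarrow> ('b \<Rightarrow>\<^sub>0 real) \<Rightarrow> ('c \<Rightarrow>\<^sub>0 real) \<Rightarrow> 'v" where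
  "bilin_ext f u v = lin_ext (\<lambda>b. lin_ext (f b) v) u"

definition graft :: "nat^'i::finite \<Rightarrow> 'i tree \<Rightarrow> 'i tree \<Rightarrow> 'i tree \<Rightarrow>\<^sub>0 real" where
  "graft a \<sigma> \<tau> = (\<Sum>w\<in>#nodes \<tau>. basis_vec (forget (graft_at a \<sigma> w)))"

definition multi_binomial :: "nat^'i::finite \<Rightarrow> nat^'i \<Rightarrow> nat" where
  "multi_binomial n l = (\<Prod>i\<in>UNIV. (n $ i) choose (l $ i))"

lemma finite_multi_index_le: "finite {l :: nat^'i::finite. l \<le> n \<and> l \<le> a}"
proof (rule finite_subset)
  show "{l. l \<le> n \<and> l \<le> a} \<subseteq> vec_lambda ` (UNIV \<rightarrow>\<^sub>E {..sum (($) n) UNIV})"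
  proof
    fix l assume "l \<in> {l. l \<le> n \<and> l \<le> a}"
    then have "l $ i \<le> sum (($) n) UNIV" for i
      by (metis (no_types, lifting) UNIV_I finite less_eq_vec_def mem_Collect_eq member_le_sum
          order_trans zero_le)
    then have "($) l \<in> UNIV \<rightarrow>\<^sub>E {..sum (($) n) UNIV}"
      by auto
    then show "l \<in> vec_lambda ` (UNIV \<rightarrow>\<^sub>E {..sum (($) n) UNIV})"
      by (metis image_eqI vec_nth_inverse)
  qed
qed (simp add: finite_PiE)

text \<open>The range of \<open>l\<close> drops exactly the terms in which \<open>a - l\<close> or \<open>node_dec w - l\<close> has a
  negative component.\<close>

definition hat_graft :: "nat^'i::finite \<Rightarrow> 'i tree \<Rightarrow> 'i tree \<Rightarrow> 'i tree \<Rightarrow>\<^sub>0 real" where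
  "hat_graft a \<sigma> \<tau> = (\<Sum>w\<in>#nodes \<tau>. \<Sum>l | l \<le> node_dec w \<and> l \<le> a.
     real (multi_binomial (node_dec w) l) *\<^sub>R
       basis_vec (forget (graft_at (a - l) \<sigma> (lower_at l w))))"

definition raise :: "'i::finite \<Rightarrow> 'i tree \<Rightarrow> 'i tree \<Rightarrow>\<^sub>0 real" where
  "raise i \<tau> = (\<Sum>w\<in>#nodes \<tau>. basis_vec (forget (raise_at (axis i 1) w)))"


section \<open>The space spanned by planted trees and monomials\<close>

text \<open>\<open>Planted a \<tau>\<close> and \<open>X i\<close> are names for the basis elements \<open>I\<^sub>a(\<tau>)\<close> and \<open>X\<^sub>i\<close>; the trees they
  stand for, given by \<open>gen_tree\<close>, are pairwise distinct.\<close>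

datatype 'i::finite gen = Planted "nat^'i" "'i tree" | X 'i

primrec gen_tree :: "'i::finite gen \<Rightarrow> 'i tree" where
  "gen_tree (Planted a \<tau>) = Node 0 {#((I_edge, a), \<tau>)#}"
| "gen_tree (X i) = Node (axis i 1) {#}"

lemma inj_gen_tree: "inj gen_tree"
proof (rule injI)
  fix g h :: "'i::finite gen"
  assume "gen_tree g = gen_tree h"
  then show "g = h"
    by (cases g; cases h) (auto simp: axis_eq_axis)
qed

definition \<V> :: "('i::finite gen \<Rightarrow>\<^sub>0 real) set" where
  "\<V> = span ({basis_vec (Planted a \<tau>) | a \<tau>. decorated \<tau>} \<union> {basis_vec (X i) | i. True})"

definition plant :: "nat^'i::finite \<Rightarrow> ('i tree \<Rightarrow>\<^sub>0 real) \<Rightarrow> ('i gen \<Rightarrow>\<^sub>0 real)" where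
  "plant a = lin_ext (\<lambda>\<tau>. basis_vec (Planted a \<tau>))"

definition plant_lowered :: "nat^'i::finite \<Rightarrow> 'i \<Rightarrow> 'i tree \<Rightarrow> ('i gen \<Rightarrow>\<^sub>0 real)" where
  "plant_lowered a i \<tau> =
     (if axis i 1 \<le> a then basis_vec (Planted (a - axis i 1) \<tau>) else 0)"

fun bracket1_gen :: "'i::finite gen \<Rightarrow> 'i gen \<Rightarrow> ('i gen \<Rightarrow>\<^sub>0 real)" where
  "bracket1_gen (Planted a \<sigma>) (Planted b \<tau>) = 0"
| "bracket1_gen (Planted a \<tau>) (X i) = plant_lowered a i \<tau>"
| "bracket1_gen (X i) (Planted a \<tau>) = - plant_lowered a i \<tau>"
| "bracket1_gen (X i) (X j) = 0"

fun tri_gen :: "'i::finite gen \<Rightarrow> 'i gen \<Rightarrow> ('i gen \<Rightarrow>\<^sub>0 real)" where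
  "tri_gen (X i) (Planted a \<tau>) = plant a (raise i \<tau>)"
| "tri_gen (Planted a \<tau>) (X i) = 0"
| "tri_gen (X i) (X j) = 0"
| "tri_gen (Planted a \<sigma>) (Planted b \<tau>) = plant b (graft a \<sigma> \<tau>)"

fun hat_tri_gen :: "'i::finite gen \<Rightarrow> 'i gen \<Rightarrow> ('i gen \<Rightarrow>\<^sub>0 real)" where
  "hat_tri_gen (X i) (Planted a \<tau>) = plant a (raise i \<tau>)"
| "hat_tri_gen (Planted a \<tau>) (X i) = 0"
| "hat_tri_gen (X i) (X j) = 0"
| "hat_tri_gen (Planted a \<sigma>) (Planted b \<tau>) = plant b (hat_graft a \<sigma> \<tau>)"

definition bracket1 ::
  "('i::finite gen \<Rightarrow>\<^sub>0 real) \<Rightarrow> ('i gen \<Rightarrow>\<^sub>0 real) \<Rightarrow> ('i gen \<Rightarrow>\<^sub>0 real)" where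
  "bracket1 = bilin_ext bracket1_gen"

definition tri ::
  "('i::finite gen \<Rightarrow>\<^sub>0 real) \<Rightarrow> ('i gen \<Rightarrow>\<^sub>0 real) \<Rightarrow> ('i gen \<Rightarrow>\<^sub>0 real)" where
  "tri = bilin_ext tri_gen"

definition hat_tri ::
  "('i::finite gen \<Rightarrow>\<^sub>0 real) \<Rightarrow> ('i gen \<Rightarrow>\<^sub>0 real) \<Rightarrow> ('i gen \<Rightarrow>\<^sub>0 real)" where
  "hat_tri = bilin_ext hat_tri_gen"

end

(* Both products act on a planted tree by an operation applied at every node, built from an
   operation on a single node.  The commutator of two such operations is again of this kind,
   because the terms in which they act at different nodes cancel.  The post-Lie identity thus
   becomes an identity for a single node, where it reduces to Pascal's rule and to the symmetry
   of trinomial coefficients.  Weighting the terms with kappa^|l| and the bracket with kappa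
   gives a post-Lie algebra for every real kappa; kappa = 0 is the pre-Lie algebra and
   kappa = 1 is its deformation. *)
theory Submission
  imports Defs
begin

section \<open>Linear extensions\<close>

lemma lin_ext_eq_sum:
  assumes "finite S" "Poly_Mapping.keys u \<subseteq> S"
  shows "lin_ext f u = (\<Sum>b\<in>S. Poly_Mapping.lookup u b *\<^sub>R f b)"
  unfolding lin_ext_def
  by (rule sum.mono_neutral_left) (use assms in \<open>auto simp: in_keys_iff\<close>)

lemma lookup_scaleR_poly_mapping [simp]:
  fixes u :: "'b \<Rightarrow>\<^sub>0 'v::real_vector"
  shows "Poly_Mapping.lookup (c *\<^sub>R u) b = c *\<^sub>R Poly_Mapping.lookup u b"
proof -
  have "finite {i. c *\<^sub>R Poly_Mapping.lookup u i \<noteq> 0}"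
    by (rule finite_subset[OF _ finite_keys[of u]]) (auto simp: in_keys_iff)
  then show ?thesis
    by (simp add: scaleR_poly_mapping_def)
qed

lemma linear_lin_ext: "linear (lin_ext f)"
proof (rule linearI)
  fix u v :: "'a \<Rightarrow>\<^sub>0 real" and c :: real
  let ?S = "Poly_Mapping.keys u \<union> Poly_Mapping.keys v"
  have "Poly_Mapping.keys (u + v) \<subseteq> ?S"
    by (rule keys_add)
  then show "lin_ext f (u + v) = lin_ext f u + lin_ext f v"
    by (simp add: lin_ext_eq_sum[of ?S] lookup_add scaleR_add_left sum.distrib)
  have "Poly_Mapping.keys (c *\<^sub>R u) \<subseteq> Poly_Mapping.keys u"
    by (auto simp: in_keys_iff)
  then show "lin_ext f (c *\<^sub>R u) = c *\<^sub>R lin_ext f u"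
    by (simp add: lin_ext_eq_sum[of "Poly_Mapping.keys u"] scaleR_sum_right)
qed

lemmas lin_ext_add [simp] = linear_add[OF linear_lin_ext]
  and lin_ext_diff [simp] = linear_diff[OF linear_lin_ext]
  and lin_ext_neg [simp] = linear_neg[OF linear_lin_ext]
  and lin_ext_zero [simp] = linear_0[OF linear_lin_ext]
  and lin_ext_scaleR [simp] = linear_scale[OF linear_lin_ext]
  and lin_ext_sum [simp] = linear_sum[OF linear_lin_ext]

lemma lin_ext_sum_mset [simp]: "lin_ext f (\<Sum>x\<in>#M. g x) = (\<Sum>x\<in>#M. lin_ext f (g x))"
  by (induction M) simp_all

lemma lin_ext_basis_vec [simp]: "lin_ext f (basis_vec b) = f b"
  by (simp add: lin_ext_def basis_vec_def)

lemma lin_ext_basis_vec_id [simp]: "lin_ext basis_vec u = u"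
proof (rule poly_mapping_eqI)
  fix k
  have "Poly_Mapping.lookup (lin_ext basis_vec u) k =
      (\<Sum>b\<in>Poly_Mapping.keys u. Poly_Mapping.lookup u b * (1 when b = k))"
    by (simp add: lin_ext_def lookup_sum basis_vec_def lookup_single)
  also have "\<dots> = (\<Sum>b\<in>Poly_Mapping.keys u. if b = k then Poly_Mapping.lookup u b else 0)"
    by (rule sum.cong) auto
  also have "\<dots> = Poly_Mapping.lookup u k"
    by (simp add: in_keys_iff)
  finally show "Poly_Mapping.lookup (lin_ext basis_vec u) k = Poly_Mapping.lookup u k" .
qed

lemma linear_lin_ext_commute:
  assumes "linear h"
  shows "h (lin_ext f u) = lin_ext (\<lambda>b. h (f b)) u"
  by (simp add: lin_ext_def linear_sum[OF assms] linear_scale[OF assms])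

lemma lin_ext_lin_ext [simp]: "lin_ext f (lin_ext g u) = lin_ext (\<lambda>b. lin_ext f (g b)) u"
  by (rule linear_lin_ext_commute[OF linear_lin_ext])

lemma linear_eq_on_basis_vec:
  assumes "linear f" "linear g" "\<And>b. f (basis_vec b) = g (basis_vec b)"
  shows "f u = g u"
  using linear_lin_ext_commute[OF assms(1), of basis_vec u]
    linear_lin_ext_commute[OF assms(2), of basis_vec u] assms(3) by simp

lemma lin_ext_fun_add: "lin_ext (\<lambda>b. f b + g b) u = lin_ext f u + lin_ext g u"
  by (simp add: lin_ext_def scaleR_add_right sum.distrib)

lemma lin_ext_fun_diff: "lin_ext (\<lambda>b. f b - g b) u = lin_ext f u - lin_ext g u"
  by (simp add: lin_ext_def scaleR_diff_right sum_subtractf)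

lemma lin_ext_fun_zero [simp]: "lin_ext (\<lambda>b. 0) u = 0"
  by (simp add: lin_ext_def)

lemma lin_ext_fun_scaleR: "lin_ext (\<lambda>b. c *\<^sub>R f b) u = c *\<^sub>R lin_ext f u"
  by (simp add: lin_ext_def scaleR_sum_right mult.commute)

lemma lin_ext_fun_sum: "lin_ext (\<lambda>b. \<Sum>x\<in>S. f x b) u = (\<Sum>x\<in>S. lin_ext (f x) u)"
  by (induction S rule: infinite_finite_induct) (simp_all add: lin_ext_fun_add)

text \<open>Exchange of finite sums. This is what cancels mixed terms in commutators: operations
  acting at unrelated places commute.\<close>

lemma lin_ext_swap:
  "lin_ext (\<lambda>b. lin_ext (\<lambda>c. f b c) v) u = lin_ext (\<lambda>c. lin_ext (\<lambda>b. f b c) u) v"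
  unfolding lin_ext_def scaleR_sum_right
  by (subst sum.swap) (simp add: mult.commute)

lemma bilinear_bilin_ext: "bilinear (bilin_ext f)"
proof -
  have "linear (\<lambda>v. bilin_ext f u v)" for u
    by (rule linearI) (simp_all add: bilin_ext_def lin_ext_fun_add lin_ext_fun_scaleR)
  moreover have "linear (\<lambda>u. bilin_ext f u v)" for v
    unfolding bilin_ext_def by (rule linear_lin_ext)
  ultimately show ?thesis
    by (simp add: bilinear_def)
qed

lemma bilin_ext_basis_vec [simp]: "bilin_ext f (basis_vec b) v = lin_ext (f b) v"
  by (simp add: bilin_ext_def)

lemma bilin_ext_basis_vec_right [simp]: "bilin_ext f u (basis_vec b) = lin_ext (\<lambda>c. f c b) u"
  by (simp add: bilin_ext_def)

section \<open>Reduction to basis vectors\<close>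

lemma bilinear_in_span:
  assumes "bilinear f" "\<And>x y. x \<in> B \<Longrightarrow> y \<in> B \<Longrightarrow> f x y \<in> span B"
    and "u \<in> span B" "v \<in> span B"
  shows "f u v \<in> span B"
proof -
  have *: "f x v \<in> span B" if "x \<in> B" for x
    using \<open>v \<in> span B\<close>
  proof (induction v rule: span_induct)
    \<comment> \<open>Here \<open>base\<close> is the claim that the vectors with the property form
      a subspace.\<close>
    case base
    then show ?case
      by (rule subspaceI)
        (auto simp: bilinear_rzero bilinear_radd bilinear_rmul assms(1) span_zero span_add
          span_scale)
  qed (use assms(2) that in auto)
  show ?thesis
    using \<open>u \<in> span B\<close>
  proof (induction u rule: span_induct)
    case base
    then show ?case
      by (rule subspaceI)
        (auto simp: bilinear_lzero bilinear_ladd bilinear_lmul assms(1) span_zero span_add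
          span_scale)
  qed (use * in auto)
qed

lemma trilinear_eq_0:
  assumes "\<And>y z. linear (\<lambda>x. F x y z)" "\<And>x z. linear (\<lambda>y. F x y z)" "\<And>x y. linear (F x y)"
    and "\<And>a b c. F (basis_vec a) (basis_vec b) (basis_vec c) = 0"
  shows "F x y z = 0"
proof -
  have zero: "linear (\<lambda>_. 0)"
    by (simp add: linear_iff)
  have "F (basis_vec a) (basis_vec b) z = 0" for a b
    using linear_eq_on_basis_vec[OF assms(3) zero] assms(4) by blast
  then have "F (basis_vec a) y z = 0" for a
    using linear_eq_on_basis_vec[OF assms(2) zero] by blast
  then show ?thesis
    using linear_eq_on_basis_vec[OF assms(1) zero] by blast
qed

text \<open>The identities are trilinear, so they spread from basis vectors to the whole ambient
  space; \<gg> enters only through closure.\<close>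

lemma post_lie_algebra_on_basis:
  fixes br tr :: "('b \<Rightarrow>\<^sub>0 real) \<Rightarrow> ('b \<Rightarrow>\<^sub>0 real) \<Rightarrow> 'b \<Rightarrow>\<^sub>0 real"
  assumes br: "bilinear br" and tr: "bilinear tr"
    and \<gg>: "subspace \<gg>" "\<And>x y. x \<in> \<gg> \<Longrightarrow> y \<in> \<gg> \<Longrightarrow> br x y \<in> \<gg>"
      "\<And>x y. x \<in> \<gg> \<Longrightarrow> y \<in> \<gg> \<Longrightarrow> tr x y \<in> \<gg>"
    and skew: "\<And>a b. br (basis_vec a) (basis_vec b) = - br (basis_vec b) (basis_vec a)"
    and jacobi: "\<And>a b c. br (basis_vec a) (br (basis_vec b) (basis_vec c))
      + br (basis_vec b) (br (basis_vec c) (basis_vec a))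
      + br (basis_vec c) (br (basis_vec a) (basis_vec b)) = 0"
    and derivation: "\<And>a b c. tr (basis_vec a) (br (basis_vec b) (basis_vec c)) =
      br (tr (basis_vec a) (basis_vec b)) (basis_vec c)
      + br (basis_vec b) (tr (basis_vec a) (basis_vec c))"
    and action: "\<And>a b c. tr (br (basis_vec a) (basis_vec b) + tr (basis_vec a) (basis_vec b)
        - tr (basis_vec b) (basis_vec a)) (basis_vec c) =
      tr (basis_vec a) (tr (basis_vec b) (basis_vec c))
      - tr (basis_vec b) (tr (basis_vec a) (basis_vec c))"
  shows "post_lie_algebra \<gg> br tr"
proof -
  \<comment> \<open>These rules yield, by resolution, linearity in one variable of nested terms such
    as \<open>br x (br y z)\<close>.\<close>
  have linear_bilinear: "linear (\<lambda>x. h (f x) y)" "linear (\<lambda>x. h y (f x))"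
    if "bilinear h" "linear f" for h :: "('b \<Rightarrow>\<^sub>0 real) \<Rightarrow> ('b \<Rightarrow>\<^sub>0 real) \<Rightarrow> 'b \<Rightarrow>\<^sub>0 real"
      and f :: "('b \<Rightarrow>\<^sub>0 real) \<Rightarrow> 'b \<Rightarrow>\<^sub>0 real" and y
    using that linear_compose[of f "\<lambda>x. h x y"] linear_compose[of f "h y"]
    by (simp_all add: bilinear_def comp_def)
  note linear_intros = linear_compose_add linear_compose_sub linear_bilinear[OF br]
    linear_bilinear[OF tr] linear_ident
  note bilinear_simps = bilinear_ladd bilinear_radd bilinear_lmul bilinear_rmul
  have skew': "br x y = - br y x" for x y
  proof -
    have basis: "br (basis_vec a) y = - br y (basis_vec a)" for a
      by (rule linear_eq_on_basis_vec[of "\<lambda>y. br (basis_vec a) y" "\<lambda>y. - br y (basis_vec a)"])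
        (intro linear_compose_neg linear_intros skew)+
    show ?thesis
      by (rule linear_eq_on_basis_vec[of "\<lambda>x. br x y" "\<lambda>x. - br y x"])
        (intro linear_compose_neg linear_intros basis)+
  qed
  \<comment> \<open>Skew symmetry gives twice \<open>br x x\<close> equal to 0, which suffices over
    the reals.\<close>
  have alternating: "br x x = 0" for x
  proof -
    have "br x x + br x x = 0"
      using skew'[of x x] by (metis add.left_inverse)
    then show ?thesis
      by (metis scaleR_2 scaleR_eq_0_iff zero_neq_numeral)
  qed
  have jacobi': "br x (br y z) + br y (br z x) + br z (br x y) = 0" for x y z
    by (rule trilinear_eq_0[where F = "\<lambda>x y z. br x (br y z) + br y (br z x) + br z (br x y)"])
      ((intro linear_intros)+, simp add: jacobi)
  have "tr x (br y z) - (br (tr x y) z + br y (tr x z)) = 0" for x y z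
    by (rule trilinear_eq_0[where F = "\<lambda>x y z. tr x (br y z) - (br (tr x y) z + br y (tr x z))"])
      ((intro linear_intros)+, simp add: derivation)
  moreover have "tr (br x y + tr x y - tr y x) z - (tr x (tr y z) - tr y (tr x z)) = 0" for x y z
    by (rule trilinear_eq_0[where
          F = "\<lambda>x y z. tr (br x y + tr x y - tr y x) z - (tr x (tr y z) - tr y (tr x z))"])
      ((intro linear_intros)+, simp add: action)
  ultimately show ?thesis
    by unfold_locales
      (auto simp: \<gg> bilinear_on_def alternating_on_def alternating jacobi' bilinear_simps[OF br]
        bilinear_simps[OF tr])
qed

section \<open>Operations acting at every node of a tree\<close>

text \<open>A node operation \<open>f\<close> replaces the decoration \<open>n\<close> of a node by \<open>n'\<close> and attaches the
  branches \<open>G\<close> to it, for each term \<open>(n', G)\<close> of the linear combination \<open>f n\<close>.\<close>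

type_synonym 'i forest = "('i edge_dec \<times> 'i tree) multiset"

type_synonym 'i node_op = "nat^'i \<Rightarrow> ((nat^'i) \<times> 'i forest \<Rightarrow>\<^sub>0 real)"

definition on_nodes :: "'i::finite node_op \<Rightarrow> 'i tree \<Rightarrow> ('i tree \<Rightarrow>\<^sub>0 real)" where
  "on_nodes f \<tau> = (\<Sum>w\<in>#nodes \<tau>. lin_ext
     (\<lambda>c. basis_vec (plug (fst w) (Node (fst c) (branches (snd w) + snd c)))) (f (node_dec w)))"

text \<open>With \<open>on_forest\<close>, this recasts the sum over pointed trees as a recursion on
  branches, which admits structural induction. The value 0 on noise edges matches
  \<open>nodes\<close>, which does not enter them.\<close>

definition on_branch ::
  "'i::finite node_op \<Rightarrow> 'i edge_dec \<times> 'i tree \<Rightarrow> ('i edge_dec \<times> 'i tree \<Rightarrow>\<^sub>0 real)" where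
  "on_branch f b = (if fst (fst b) = I_edge
     then lin_ext (\<lambda>t. basis_vec (fst b, t)) (on_nodes f (snd b)) else 0)"

definition on_forest :: "'i::finite node_op \<Rightarrow> 'i forest \<Rightarrow> ('i forest \<Rightarrow>\<^sub>0 real)" where
  "on_forest f F = (\<Sum>b\<in>#F. lin_ext (\<lambda>b'. basis_vec (add_mset b' (F - {#b#}))) (on_branch f b))"

section \<open>Recursion along branches and the Leibniz rule\<close>

lemma sum_mset_image_sum_mset:
  fixes h :: "'b \<Rightarrow> 'c::comm_monoid_add"
  shows "(\<Sum>w\<in>#(\<Sum>x\<in>#M. g x). h w) = (\<Sum>x\<in>#M. \<Sum>w\<in>#g x. h w)"
  by (induction M) simp_all

text \<open>A pointed node is either the root, with empty path, or lies in one branch, whose edge is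
  the first step of its path.\<close>

lemma on_nodes_Node:
  "on_nodes f (Node n F) = lin_ext (\<lambda>c. basis_vec (Node (fst c) (F + snd c))) (f n)
     + lin_ext (\<lambda>F'. basis_vec (Node n F')) (on_forest f F)"
  by (auto simp: on_nodes_def on_forest_def on_branch_def node_dec_def sum_mset_image_sum_mset
      case_prod_unfold image_mset.compositionality comp_def
      intro!: arg_cong[where f = sum_mset] image_mset_cong)

lemma on_forest_empty [simp]: "on_forest f {#} = 0"
  by (simp add: on_forest_def)

lemma on_forest_single [simp]:
  "on_forest f {#b#} = lin_ext (\<lambda>b'. basis_vec {#b'#}) (on_branch f b)"
  by (simp add: on_forest_def)

lemma on_forest_union:
  "on_forest f (F + G) = lin_ext (\<lambda>F'. basis_vec (F' + G)) (on_forest f F)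
     + lin_ext (\<lambda>G'. basis_vec (F + G')) (on_forest f G)"
proof -
  \<comment> \<open>Multiset subtraction truncates, so the removal may be assigned to a summand only
    if that summand contains \<open>b\<close>.\<close>
  have "F + G - {#b#} = (F - {#b#}) + G" if "b \<in># F" for b
    using that by (metis add.commute diff_union_single_conv)
  moreover have "F + G - {#b#} = F + (G - {#b#})" if "b \<in># G" for b
    using that by (metis diff_union_single_conv)
  ultimately show ?thesis
    by (simp add: on_forest_def cong: image_mset_cong)
qed

lemma on_forest_add_mset:
  "on_forest f (add_mset b F) = lin_ext (\<lambda>b'. basis_vec (add_mset b' F)) (on_branch f b)
     + lin_ext (\<lambda>F'. basis_vec (add_mset b F')) (on_forest f F)"
  using on_forest_union[of f "{#b#}" F] by simp

text \<open>\<open>node_comp f g\<close> collects the terms of \<open>on_nodes f \<circ> on_nodes g\<close> in which \<open>f\<close> acts at the node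
  where \<open>g\<close> has acted, or at a node of a branch that \<open>g\<close> has attached.\<close>

definition node_comp :: "'i::finite node_op \<Rightarrow> 'i node_op \<Rightarrow> 'i node_op" where
  "node_comp f g n = lin_ext (\<lambda>c.
     lin_ext (\<lambda>c'. basis_vec (fst c', snd c + snd c')) (f (fst c))
     + lin_ext (\<lambda>G. basis_vec (fst c, G)) (on_forest f (snd c))) (g n)"

definition node_comm :: "'i::finite node_op \<Rightarrow> 'i node_op \<Rightarrow> 'i node_op" where
  "node_comm f g n = node_comp f g n - node_comp g f n"

text \<open>The assumption is the induction hypothesis of the theorem on trees. By the Leibniz rule,
  \<open>f\<close> and \<open>g\<close> act in the same branch or in different ones; the latter
  terms occur in both orders and cancel.\<close>

lemma on_forest_commutator:
  assumes "\<And>e t. (e, t) \<in># F \<Longrightarrow>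
    lin_ext (on_nodes f) (on_nodes g t) - lin_ext (on_nodes g) (on_nodes f t)
      = on_nodes (node_comm f g) t"
  shows "lin_ext (on_forest f) (on_forest g F) - lin_ext (on_forest g) (on_forest f F)
    = on_forest (node_comm f g) F"
  using assms
proof (induction F)
  case empty
  then show ?case
    by simp
next
  case (add b F)
  have "lin_ext (on_branch f) (on_branch g b) - lin_ext (on_branch g) (on_branch f b) =
    on_branch (node_comm f g) b"
    using add.prems[of "fst b" "snd b", symmetric] by (simp add: on_branch_def)
  note branch = this[symmetric]
  have forest: "on_forest (node_comm f g) F =
    lin_ext (on_forest f) (on_forest g F) - lin_ext (on_forest g) (on_forest f F)"
    by (rule add.IH[symmetric]) (use add.prems in auto)
  show ?case
    by (simp add: on_forest_add_mset branch forest lin_ext_fun_add lin_ext_fun_diff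
        lin_ext_swap[of _ "on_branch f b" "on_forest g F"]
        lin_ext_swap[of _ "on_branch g b" "on_forest f F"])
qed

text \<open>Terms with one operation at the root and the other in an original branch cancel. Both in
  original branches is the induction hypothesis; the rest happens at the root or in branches just
  attached to it, which is \<open>node_comm\<close>.\<close>

theorem on_nodes_commutator:
  "lin_ext (on_nodes f) (on_nodes g \<tau>) - lin_ext (on_nodes g) (on_nodes f \<tau>)
     = on_nodes (node_comm f g) \<tau>"
proof (induction \<tau>)
  case (Node n F)
  have forest: "on_forest (node_comm f g) F =
    lin_ext (on_forest f) (on_forest g F) - lin_ext (on_forest g) (on_forest f F)"
    by (rule on_forest_commutator[symmetric]) (use Node in fastforce)
  show ?case
    by (simp add: on_nodes_Node forest node_comm_def[of f g n] node_comp_def[of _ _ n] on_forest_union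
        lin_ext_fun_add lin_ext_fun_diff add.assoc
        lin_ext_swap[of _ "f n" "on_forest g F"]
        lin_ext_swap[of _ "g n" "on_forest f F"])
qed

text \<open>Linearity in the operation lets a linear combination of generators act as a single node
  operation.\<close>

lemma on_nodes_lin_ext:
  fixes f :: "'a \<Rightarrow> 'b::finite node_op"
  shows "on_nodes (\<lambda>n. lin_ext (\<lambda>b. f b n) u) \<tau> = lin_ext (\<lambda>b. on_nodes (f b) \<tau>) u"
proof -
  have "lin_ext (\<lambda>b. \<Sum>w\<in>#M. h w b) u = (\<Sum>w\<in>#M. lin_ext (h w) u)"
    for M :: "'b pointed multiset" and h :: "'b pointed \<Rightarrow> 'a \<Rightarrow> 'b tree \<Rightarrow>\<^sub>0 real"
    by (induction M) (simp_all add: lin_ext_fun_add)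
  then show ?thesis
    by (simp add: on_nodes_def lin_ext_swap)
qed

section \<open>Interpolation between grafting and deformed grafting\<close>

text \<open>Keeps \<open>axis i 1\<close> from being rewritten with \<open>Suc 0\<close>.\<close>

declare One_nat_def [simp del]

text \<open>With the powers of \<open>\<kappa>\<close>, the weight interpolates between \<open>graft\<close> at \<open>\<kappa> = 0\<close>, where only
  \<open>l = 0\<close> survives because \<open>0 ^ 0 = 1\<close>, and \<open>hat_graft\<close> at \<open>\<kappa> = 1\<close>.\<close>

definition weight :: "real \<Rightarrow> nat^'i::finite \<Rightarrow> nat^'i \<Rightarrow> real" where
  "weight \<kappa> n l = \<kappa> ^ (\<Sum>i\<in>UNIV. l $ i) * real (multi_binomial n l)"

definition raise_op :: "'i::finite \<Rightarrow> 'i node_op" where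
  "raise_op i n = basis_vec (n + axis i 1, {#})"

definition graft_op :: "real \<Rightarrow> nat^'i::finite \<Rightarrow> 'i tree \<Rightarrow> 'i node_op" where
  "graft_op \<kappa> a \<sigma> n = (\<Sum>l | l \<le> n \<and> l \<le> a.
     weight \<kappa> n l *\<^sub>R basis_vec (n - l, {#((I_edge, a - l), \<sigma>)#}))"

section \<open>Symmetry and Pascal's rule for multi-index binomials\<close>

lemma multi_binomial_0 [simp]: "multi_binomial n 0 = 1"
  by (simp add: multi_binomial_def)

lemma multi_binomial_eq_0: "\<not> l \<le> n \<Longrightarrow> multi_binomial n l = 0"
  by (auto simp: multi_binomial_def less_eq_vec_def not_le)

text \<open>Both sides are the trinomial coefficient of \<open>l\<close>, \<open>m\<close> and
  \<open>n - l - m\<close>. If \<open>l + m\<close> exceeds \<open>n\<close>, a factor vanishes on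
  each side, also under truncated subtraction.\<close>

lemma choose_choose_commute: "(n choose l) * ((n - l) choose m) = (n choose m) * ((n - m) choose l)"
proof (cases "l + m \<le> n")
  case True
  have "(n choose (l + m)) * ((l + m) choose l) = (n choose l) * ((n - l) choose m)"
    using choose_mult[of l "l + m" n] True by simp
  moreover have "(n choose (l + m)) * ((l + m) choose m) = (n choose m) * ((n - m) choose l)"
    using choose_mult[of m "l + m" n] True by simp
  moreover have "(l + m) choose l = (l + m) choose m"
    using binomial_symmetric[of l "l + m"] by simp
  ultimately show ?thesis
    by simp
next
  case False
  then have "n < l \<or> n - l < m" "n < m \<or> n - m < l"
    by auto
  then show ?thesis
    by (metis binomial_eq_0 mult_0 mult_0_right)
qed

lemma weight_weight_commute: "weight \<kappa> n l * weight \<kappa> (n - l) m = weight \<kappa> n m * weight \<kappa> (n - m) l"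
proof -
  have "multi_binomial n l * multi_binomial (n - l) m = multi_binomial n m * multi_binomial (n - m) l"
    by (simp add: multi_binomial_def choose_choose_commute flip: prod.distrib)
  then have "real (multi_binomial n l) * real (multi_binomial (n - l) m) =
      real (multi_binomial n m) * real (multi_binomial (n - m) l)"
    by (metis of_nat_mult)
  then show ?thesis
    by (simp add: weight_def mult.assoc mult.left_commute)
qed

lemma axis_le_iff: "axis i 1 \<le> l \<longleftrightarrow> 0 < l $ i" for l :: "nat^'i::finite"
  by (auto simp: less_eq_vec_def axis_def Suc_le_eq)

text \<open>Pascal's rule in component \<open>i\<close>; the other factors of the product do not
  change.\<close>

lemma multi_binomial_add_axis:
  "multi_binomial (n + axis i 1) l =
     multi_binomial n l + (if axis i 1 \<le> l then multi_binomial n (l - axis i 1) else 0)"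
proof -
  have split: "multi_binomial m k = ((m $ i) choose (k $ i)) * (\<Prod>j\<in>UNIV - {i}. (m $ j) choose (k $ j))"
    for m k
    by (simp add: multi_binomial_def prod.remove[of UNIV i])
  have "(\<Prod>j\<in>UNIV - {i}. (n + axis i 1) $ j choose (l $ j)) = (\<Prod>j\<in>UNIV - {i}. (n $ j) choose (l $ j))"
    by (rule prod.cong) (auto simp: axis_def)
  moreover have "(\<Prod>j\<in>UNIV - {i}. (n $ j) choose ((l - axis i 1) $ j)) =
      (\<Prod>j\<in>UNIV - {i}. (n $ j) choose (l $ j))"
    by (rule prod.cong) (auto simp: axis_def)
  ultimately show ?thesis
    by (cases "l $ i") (simp_all add: split axis_le_iff axis_nth plus_1_eq_Suc algebra_simps)
qed

text \<open>The second Pascal term has an index of total degree one less, which leaves one factor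
  \<kappa> over. This is the \<kappa> that later scales the bracket.\<close>

lemma weight_add_axis:
  "weight \<kappa> (n + axis i 1) l =
     weight \<kappa> n l + (if axis i 1 \<le> l then \<kappa> * weight \<kappa> n (l - axis i 1) else 0)"
proof (cases "axis i 1 \<le> l")
  case True
  have "(\<Sum>j\<in>UNIV - {i}. (l - axis i 1) $ j) = (\<Sum>j\<in>UNIV - {i}. l $ j)"
    by (rule sum.cong) (auto simp: axis_def)
  with True have "(\<Sum>j\<in>UNIV. l $ j) = Suc (\<Sum>j\<in>UNIV. (l - axis i 1) $ j)"
    by (simp add: sum.remove[of UNIV i] axis_le_iff axis_nth)
  with True show ?thesis
    by (simp add: weight_def multi_binomial_add_axis distrib_left mult.assoc)
next
  case False
  then show ?thesis
    by (simp add: weight_def multi_binomial_add_axis)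
qed

section \<open>Both products as members of one family\<close>

lemma raise_eq_on_nodes: "raise i \<tau> = on_nodes (raise_op i) \<tau>"
  by (simp add: raise_def on_nodes_def raise_op_def forget_def raise_at_def node_dec_def)

lemma hat_graft_eq_on_nodes: "hat_graft a \<sigma> \<tau> = on_nodes (graft_op 1 a \<sigma>) \<tau>"
  by (simp add: hat_graft_def on_nodes_def graft_op_def forget_def graft_at_def lower_at_def
      node_dec_def weight_def)

lemma graft_op_0: "graft_op 0 a \<sigma> n = basis_vec (n, {#((I_edge, a), \<sigma>)#})"
proof -
  have "weight 0 n l = (if l = 0 then 1 else 0)" for l
    by (cases "l = 0") (simp add: weight_def, auto simp: weight_def power_0_left vec_eq_iff)
  \<comment> \<open>The surviving index 0 lies in the range of summation.\<close>
  moreover have "0 \<le> n" "0 \<le> a"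
    by (simp_all add: less_eq_vec_def)
  ultimately show ?thesis
    by (simp add: graft_op_def finite_multi_index_le if_distrib[of "\<lambda>c. c *\<^sub>R _"] cong: if_cong)
qed

lemma graft_eq_on_nodes: "graft a \<sigma> \<tau> = on_nodes (graft_op 0 a \<sigma>) \<tau>"
  by (simp add: graft_def on_nodes_def graft_op_0 forget_def graft_at_def node_dec_def)

primrec gen_op :: "real \<Rightarrow> 'i::finite gen \<Rightarrow> 'i node_op" where
  "gen_op \<kappa> (X i) = raise_op i"
| "gen_op \<kappa> (Planted a \<sigma>) = graft_op \<kappa> a \<sigma>"

primrec interp_tri_gen :: "real \<Rightarrow> 'i::finite gen \<Rightarrow> 'i gen \<Rightarrow> ('i gen \<Rightarrow>\<^sub>0 real)" where
  "interp_tri_gen \<kappa> g (X i) = 0"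
| "interp_tri_gen \<kappa> g (Planted b \<tau>) = plant b (on_nodes (gen_op \<kappa> g) \<tau>)"

lemma tri_eq: "tri = bilin_ext (interp_tri_gen 0)"
proof -
  have "tri_gen g h = interp_tri_gen 0 g h" for g h :: "'a gen"
    by (cases g; cases h) (simp_all add: raise_eq_on_nodes graft_eq_on_nodes)
  then have "tri_gen = (interp_tri_gen 0 :: 'a gen \<Rightarrow> _)"
    by (intro ext)
  then show ?thesis
    by (simp add: tri_def)
qed

lemma hat_tri_eq: "hat_tri = bilin_ext (interp_tri_gen 1)"
proof -
  have "hat_tri_gen g h = interp_tri_gen 1 g h" for g h :: "'a gen"
    by (cases g; cases h) (simp_all add: raise_eq_on_nodes hat_graft_eq_on_nodes)
  then have "hat_tri_gen = (interp_tri_gen 1 :: 'a gen \<Rightarrow> _)"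
    by (intro ext)
  then show ?thesis
    by (simp add: hat_tri_def)
qed

lemma interp_tri_plant:
  "lin_ext (interp_tri_gen \<kappa> g) (plant b u) = plant b (lin_ext (on_nodes (gen_op \<kappa> g)) u)"
  by (simp add: plant_def)

section \<open>Commutators of the operations attached to the generators\<close>

text \<open>The part of \<open>node_comp\<close> in which both operations act at the same node,
  without the attached branches.\<close>

definition root_comp :: "'i::finite node_op \<Rightarrow> 'i node_op \<Rightarrow> 'i node_op" where
  "root_comp f g n =
     lin_ext (\<lambda>c. lin_ext (\<lambda>c'. basis_vec (fst c', snd c + snd c')) (f (fst c))) (g n)"

text \<open>Acting inside the freshly attached copy of \<open>\<sigma>\<close> amounts to grafting
  the result of acting on \<open>\<sigma>\<close>, with the same weights and edge decorations. Hence
  products of generators appear; \<open>X i\<close> attaches no branch.\<close>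

lemma node_comp_gen_op:
  "node_comp f (gen_op \<kappa> h) n = root_comp f (gen_op \<kappa> h) n +
     (case h of X i \<Rightarrow> 0
      | Planted b \<sigma> \<Rightarrow> lin_ext (\<lambda>k. gen_op \<kappa> k n) (plant b (on_nodes f \<sigma>)))"
proof (cases h)
  case (Planted b \<sigma>)
  then show ?thesis
    by (simp add: node_comp_def root_comp_def lin_ext_fun_add graft_op_def on_branch_def
        plant_def lin_ext_fun_sum lin_ext_fun_scaleR)
next
  case (X i)
  then show ?thesis
    by (simp add: node_comp_def root_comp_def raise_op_def)
qed

text \<open>The branches form a multiset, so only the weights could depend on the order, and these
  are symmetric under exchanging \<open>l\<close> and \<open>m\<close>.\<close>

lemma root_comp_graft_op_graft_op:
  "root_comp (graft_op \<kappa> a \<sigma>) (graft_op \<kappa> b \<rho>) n = root_comp (graft_op \<kappa> b \<rho>) (graft_op \<kappa> a \<sigma>) n"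
proof -
  \<comment> \<open>\<open>l\<close> is the part of the decoration consumed by the grafting that
    acts first, \<open>m\<close> the part consumed by the second.\<close>
  define S :: "nat^'a \<Rightarrow> nat^'a \<Rightarrow> ((nat^'a) \<times> (nat^'a)) set" where
    "S a b = (SIGMA l:{l. l \<le> n \<and> l \<le> b}. {m. m \<le> n - l \<and> m \<le> a})" for a b
  have sum: "root_comp (graft_op \<kappa> a \<sigma>) (graft_op \<kappa> b \<rho>) n = (\<Sum>(l, m)\<in>S a b.
      (weight \<kappa> n l * weight \<kappa> (n - l) m) *\<^sub>R
      basis_vec (n - l - m, {#((I_edge, b - l), \<rho>), ((I_edge, a - m), \<sigma>)#}))" for a b \<sigma> \<rho>
    unfolding S_def
    by (subst sum.Sigma[symmetric])
      (simp_all add: root_comp_def graft_op_def finite_multi_index_le scaleR_sum_right add_mset_commute)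
  \<comment> \<open>Makes the range of summation visibly symmetric.\<close>
  have "x \<le> z \<and> y \<le> z - x \<longleftrightarrow> x + y \<le> z" for x y z :: nat
    by auto
  then have "l \<le> n \<and> m \<le> n - l \<longleftrightarrow> l + m \<le> n" for l m
    by (simp add: less_eq_vec_def flip: all_conj_distrib)
  then have S: "(l, m) \<in> S a b \<Longrightarrow> (m, l) \<in> S b a" for l m a b
    by (simp add: S_def) (metis add.commute)
  have diff: "n - l - m = n - m - l" for l m :: "nat^'a"
    by (simp add: vec_eq_iff add.commute)
  show ?thesis
    unfolding sum
    by (rule sum.reindex_bij_witness[where i = "\<lambda>(l, m). (m, l)" and j = "\<lambda>(l, m). (m, l)"])
      (auto intro: S simp: weight_weight_commute diff add_mset_commute)
qed

text \<open>Grafting after raising sees the decoration increased by \<open>axis i 1\<close>.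
  Pascal's rule isolates the excess, and shifting \<open>l\<close> turns it into grafting along an
  edge lowered by \<open>axis i 1\<close>: the bracket.\<close>

lemma root_comp_raise_op_graft_op:
  "root_comp (raise_op i) (graft_op \<kappa> a \<sigma>) n - root_comp (graft_op \<kappa> a \<sigma>) (raise_op i) n =
     - (\<kappa> *\<^sub>R lin_ext (\<lambda>k. gen_op \<kappa> k n) (plant_lowered a i \<sigma>))"
proof -
  let ?e = "axis i 1 :: nat^'a"
  let ?S = "{l. l \<le> n + ?e \<and> l \<le> a}"
  let ?B = "\<lambda>l. basis_vec (n + ?e - l, {#((I_edge, a - l), \<sigma>)#})"
  have fin: "finite ?S"
    by (rule finite_multi_index_le)
  have "root_comp (raise_op i) (graft_op \<kappa> a \<sigma>) n =
      (\<Sum>l | l \<le> n \<and> l \<le> a. weight \<kappa> n l *\<^sub>R basis_vec (n - l + ?e, {#((I_edge, a - l), \<sigma>)#}))"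
    by (simp add: root_comp_def raise_op_def graft_op_def)
  also have "\<dots> = (\<Sum>l | l \<le> n \<and> l \<le> a. weight \<kappa> n l *\<^sub>R ?B l)"
    by (intro sum.cong arg_cong2[where f = scaleR] arg_cong[where f = basis_vec])
      (auto simp: vec_eq_iff less_eq_vec_def)
  \<comment> \<open>The larger range of the other order serves for both sums, as the added terms
    have binomial 0.\<close>
  also have "\<dots> = (\<Sum>l\<in>?S. weight \<kappa> n l *\<^sub>R ?B l)"
  proof (rule sum.mono_neutral_left[OF fin])
    show "{l. l \<le> n \<and> l \<le> a} \<subseteq> ?S"
      by (auto simp: less_eq_vec_def trans_le_add1)
  qed (auto simp: weight_def multi_binomial_eq_0)
  finally have raise_graft: "root_comp (raise_op i) (graft_op \<kappa> a \<sigma>) n =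
    (\<Sum>l\<in>?S. weight \<kappa> n l *\<^sub>R ?B l)" .
  have graft_raise: "root_comp (graft_op \<kappa> a \<sigma>) (raise_op i) n = (\<Sum>l\<in>?S. weight \<kappa> (n + ?e) l *\<^sub>R ?B l)"
    by (simp add: root_comp_def raise_op_def graft_op_def)
  have "root_comp (graft_op \<kappa> a \<sigma>) (raise_op i) n - root_comp (raise_op i) (graft_op \<kappa> a \<sigma>) n =
      (\<Sum>l\<in>?S. if ?e \<le> l then (\<kappa> * weight \<kappa> n (l - ?e)) *\<^sub>R ?B l else 0)"
    unfolding raise_graft graft_raise sum_subtractf[symmetric]
    by (rule sum.cong) (simp_all add: weight_add_axis scaleR_add_left)
  also have "\<dots> = (\<Sum>l | l \<in> ?S \<and> ?e \<le> l. (\<kappa> * weight \<kappa> n (l - ?e)) *\<^sub>R ?B l)"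
    by (rule sum.inter_filter[OF fin, symmetric])
  also have "\<dots> = \<kappa> *\<^sub>R lin_ext (\<lambda>k. gen_op \<kappa> k n) (plant_lowered a i \<sigma>)"
  proof (cases "?e \<le> a")
    case True
    have "(\<Sum>l | l \<in> ?S \<and> ?e \<le> l. (\<kappa> * weight \<kappa> n (l - ?e)) *\<^sub>R ?B l) =
        (\<Sum>l | l \<le> n \<and> l \<le> a - ?e. (\<kappa> * weight \<kappa> n l) *\<^sub>R
          basis_vec (n - l, {#((I_edge, a - ?e - l), \<sigma>)#}))"
    proof (rule sum.reindex_bij_witness[where i = "\<lambda>l. l + ?e" and j = "\<lambda>l. l - ?e"], goal_cases)
      case (1 l)
      then show ?case
        by (auto simp: vec_eq_iff less_eq_vec_def)
    next
      case (2 l)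
      then show ?case
        by (fastforce simp: less_eq_vec_def intro: diff_le_mono le_diff_conv[THEN iffD2])
    next
      case (3 l)
      then show ?case
        by (auto simp: vec_eq_iff)
    next
      case (4 l)
      show ?case
        using 4 True by (auto simp: less_eq_vec_def le_diff_conv2)
    next
      case (5 l)
      then have "n + ?e - l = n - (l - ?e)" "a - l = a - ?e - (l - ?e)"
        by (auto simp: vec_eq_iff less_eq_vec_def)
      then show ?case
        by simp
    qed
    with True show ?thesis
      by (simp add: plant_lowered_def graft_op_def scaleR_sum_right)
  next
    case False
    \<comment> \<open>An index between \<open>?e\<close> and \<open>a\<close> would force
      \<open>?e \<le> a\<close>.\<close>
    then have empty: "{l. l \<in> ?S \<and> ?e \<le> l} = {}"
      by (auto dest: order_trans)
    show ?thesis
      using False unfolding empty by (simp add: plant_lowered_def)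
  qed
  finally show ?thesis
    by (simp add: algebra_simps)
qed

text \<open>At a common node the commutator gives the bracket; inside the branch attached by
  \<open>h\<close> or \<open>g\<close> it gives the two products. Together they form the left factor
  of the action identity.\<close>

lemma node_comm_gen_op:
  "node_comm (gen_op \<kappa> g) (gen_op \<kappa> h) n =
     lin_ext (\<lambda>k. gen_op \<kappa> k n)
       (\<kappa> *\<^sub>R bracket1_gen g h + interp_tri_gen \<kappa> g h - interp_tri_gen \<kappa> h g)"
proof -
  have "root_comp (gen_op \<kappa> g) (gen_op \<kappa> h) n - root_comp (gen_op \<kappa> h) (gen_op \<kappa> g) n =
      \<kappa> *\<^sub>R lin_ext (\<lambda>k. gen_op \<kappa> k n) (bracket1_gen g h)"
  proof (cases g; cases h)
    fix a \<sigma> b \<rho>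
    assume "g = Planted a \<sigma>" "h = Planted b \<rho>"
    then show ?thesis
      by (simp add: root_comp_graft_op_graft_op[of \<kappa> a \<sigma>])
  next
    fix a \<sigma> i
    assume "g = Planted a \<sigma>" "h = X i"
    then show ?thesis
      using root_comp_raise_op_graft_op[of i \<kappa> a \<sigma> n] by (simp add: algebra_simps)
  next
    fix a \<sigma> i
    assume "g = X i" "h = Planted a \<sigma>"
    then show ?thesis
      using root_comp_raise_op_graft_op[of i \<kappa> a \<sigma> n] by simp
  next
    fix i j
    assume "g = X i" "h = X j"
    then show ?thesis
      by (simp add: root_comp_def raise_op_def add_ac)
  qed
  moreover have "(case h of X i \<Rightarrow> 0 | Planted b \<sigma> \<Rightarrow>
      lin_ext (\<lambda>k. gen_op \<kappa> k n) (plant b (on_nodes (gen_op \<kappa> g) \<sigma>))) =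
      lin_ext (\<lambda>k. gen_op \<kappa> k n) (interp_tri_gen \<kappa> g h)" for g h
    by (cases h) simp_all
  ultimately show ?thesis
    by (simp add: node_comm_def node_comp_gen_op algebra_simps)
qed

text \<open>On a planted tree this is the commutator theorem below the planting edge; on monomials
  both sides vanish.\<close>

lemma interp_tri_action:
  "lin_ext (\<lambda>k. interp_tri_gen \<kappa> k c)
       (\<kappa> *\<^sub>R bracket1_gen g h + interp_tri_gen \<kappa> g h - interp_tri_gen \<kappa> h g) =
     lin_ext (interp_tri_gen \<kappa> g) (interp_tri_gen \<kappa> h c)
     - lin_ext (interp_tri_gen \<kappa> h) (interp_tri_gen \<kappa> g c)"
proof (cases c)
  case (Planted b \<tau>)
  let ?u = "\<kappa> *\<^sub>R bracket1_gen g h + interp_tri_gen \<kappa> g h - interp_tri_gen \<kappa> h g"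
  have "lin_ext (interp_tri_gen \<kappa> g) (interp_tri_gen \<kappa> h c)
        - lin_ext (interp_tri_gen \<kappa> h) (interp_tri_gen \<kappa> g c) =
      plant b (lin_ext (on_nodes (gen_op \<kappa> g)) (on_nodes (gen_op \<kappa> h) \<tau>)
        - lin_ext (on_nodes (gen_op \<kappa> h)) (on_nodes (gen_op \<kappa> g) \<tau>))"
    using Planted by (simp only: interp_tri_gen.simps interp_tri_plant) (simp add: plant_def)
  also have "\<dots> = plant b (on_nodes (\<lambda>n. lin_ext (\<lambda>k. gen_op \<kappa> k n) ?u) \<tau>)"
    unfolding on_nodes_commutator node_comm_gen_op[abs_def] ..
  also have "\<dots> = lin_ext (\<lambda>k. interp_tri_gen \<kappa> k c) ?u"
    unfolding on_nodes_lin_ext plant_def lin_ext_lin_ext by (simp add: Planted plant_def)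
  finally show ?thesis ..
qed simp

section \<open>The post-Lie structures\<close>

lemma decorated_iff:
  "decorated (Node n F) \<longleftrightarrow>
     (\<forall>a t. ((I_edge, a), t) \<in># F \<longrightarrow> decorated t) \<and>
     (\<forall>a t. ((Xi_edge, a), t) \<in># F \<longrightarrow> a = 0 \<and> t = Node 0 {#}) \<and>
     size {#b \<in># F. fst (fst b) = Xi_edge#} \<le> 1"
  by (subst decorated.simps) auto

text \<open>Paths in \<open>nodes\<close> follow only edges of type I, so replacing the subtree at
  their end never touches a noise edge along the path.\<close>

lemma decorated_plug:
  "w \<in># nodes \<tau> \<Longrightarrow> decorated \<tau> \<Longrightarrow>
     decorated (snd w) \<and> (\<forall>s. decorated s \<longrightarrow> decorated (plug (fst w) s))"
proof (induction \<tau> arbitrary: w rule: nodes.induct)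
  case (1 n F)
  show ?case
  proof (cases "w = ([], Node n F)")
    case True
    with 1 show ?thesis
      by simp
  next
    case False
    with "1.prems" obtain a t p s where b: "((I_edge, a), t) \<in># F" "(p, s) \<in># nodes t"
      and w: "w = ((n, F - {#((I_edge, a), t)#}, (I_edge, a)) # p, s)"
      by (fastforce split: if_splits)
    obtain G where F: "F = add_mset ((I_edge, a), t) G"
      using b by (metis multi_member_split)
    have "decorated t"
      using b "1.prems" by (auto simp: decorated_iff)
    with "1.IH"[OF b(1) refl _ b(2)]
    have "decorated s" "\<And>s'. decorated s' \<Longrightarrow> decorated (plug p s')"
      by auto
    with "1.prems" show ?thesis
      by (auto simp: w F decorated_iff)
  qed
qed

lemma in_\<V>_Planted: "decorated \<tau> \<Longrightarrow> basis_vec (Planted a \<tau>) \<in> \<V>"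
  unfolding \<V>_def by (rule span_base) auto

lemma subspace_\<V>: "subspace \<V>"
  by (simp add: \<V>_def)

lemma in_\<V>_sum_mset: "(\<And>x. x \<in># M \<Longrightarrow> f x \<in> \<V>) \<Longrightarrow> (\<Sum>x\<in>#M. f x) \<in> \<V>"
  by (induction M) (auto simp: subspace_\<V> subspace_0 subspace_add)

text \<open>New edges are of type I and the leaves of noise edges are never altered, so every
  resulting tree is decorated.\<close>

lemma gen_op_in_\<V>:
  assumes "\<And>a \<sigma>. g = Planted a \<sigma> \<Longrightarrow> decorated \<sigma>" "decorated \<tau>"
  shows "plant b (on_nodes (gen_op \<kappa> g) \<tau>) \<in> \<V>"
  unfolding on_nodes_def plant_def lin_ext_sum_mset lin_ext_lin_ext lin_ext_basis_vec
proof (rule in_\<V>_sum_mset)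
  fix w
  assume w: "w \<in># nodes \<tau>"
  then have dec: "decorated (snd w)" "\<And>s. decorated s \<Longrightarrow> decorated (plug (fst w) s)"
    using decorated_plug assms(2) by blast+
  obtain n F where nF: "snd w = Node n F"
    by (cases "snd w")
  show "lin_ext (\<lambda>c. basis_vec (Planted b (plug (fst w) (Node (fst c) (branches (snd w) + snd c)))))
      (gen_op \<kappa> g (node_dec w)) \<in> \<V>"
  proof (cases g)
    case (Planted a \<sigma>)
    have "decorated (Node m (add_mset ((I_edge, a'), \<sigma>) F))" for m a'
      using dec(1) assms(1)[OF Planted] by (auto simp: decorated_iff nF)
    then show ?thesis
      using Planted
      by (auto simp: graft_op_def nF
          intro!: subspace_sum subspace_\<V> subspace_scale in_\<V>_Planted dec(2))
  next
    case (X i)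
    have "decorated (Node m F)" for m
      using dec(1) by (auto simp: decorated_iff nF)
    then show ?thesis
      using X by (auto simp: raise_op_def nF intro!: in_\<V>_Planted dec(2))
  qed
qed

lemma bilin_ext_in_\<V>:
  fixes f :: "'i::finite gen \<Rightarrow> 'i gen \<Rightarrow> ('i gen \<Rightarrow>\<^sub>0 real)"
  assumes "\<And>g h. \<lbrakk>\<And>a \<tau>. g = Planted a \<tau> \<Longrightarrow> decorated \<tau>;
      \<And>a \<tau>. h = Planted a \<tau> \<Longrightarrow> decorated \<tau>\<rbrakk> \<Longrightarrow> f g h \<in> \<V>"
    and "u \<in> \<V>" "v \<in> \<V>"
  shows "bilin_ext f u v \<in> \<V>"
proof -
  let ?B = "{basis_vec (Planted a \<tau>) | a \<tau>. decorated \<tau>} \<union> {basis_vec (X i) | i. True}"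
  have closed: "bilin_ext f x y \<in> span ?B" if xy: "x \<in> ?B" "y \<in> ?B" for x y
  proof -
    obtain g h where "x = basis_vec g" "\<And>a \<tau>. g = Planted a \<tau> \<Longrightarrow> decorated \<tau>"
      and "y = basis_vec h" "\<And>a \<tau>. h = Planted a \<tau> \<Longrightarrow> decorated \<tau>"
      using xy by blast
    then show ?thesis
      using assms(1)[of g h] by (simp add: \<V>_def)
  qed
  show ?thesis
    unfolding \<V>_def
    by (rule bilinear_in_span[OF bilinear_bilin_ext])
      (rule closed assms(2,3)[unfolded \<V>_def] | assumption)+
qed

lemma interp_tri_in_\<V>: "u \<in> \<V> \<Longrightarrow> v \<in> \<V> \<Longrightarrow> bilin_ext (interp_tri_gen \<kappa>) u v \<in> \<V>"
proof (rule bilin_ext_in_\<V>)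
  fix g h :: "'a gen"
  assume "\<And>a \<tau>. g = Planted a \<tau> \<Longrightarrow> decorated \<tau>" "\<And>a \<tau>. h = Planted a \<tau> \<Longrightarrow> decorated \<tau>"
  then show "interp_tri_gen \<kappa> g h \<in> \<V>"
    by (cases h) (auto simp: subspace_0 subspace_\<V> intro!: gen_op_in_\<V>)
qed

lemma bracket1_in_\<V>: "u \<in> \<V> \<Longrightarrow> v \<in> \<V> \<Longrightarrow> bracket1 u v \<in> \<V>"
  unfolding bracket1_def
proof (rule bilin_ext_in_\<V>)
  fix g h :: "'a gen"
  assume "\<And>a \<tau>. g = Planted a \<tau> \<Longrightarrow> decorated \<tau>" "\<And>a \<tau>. h = Planted a \<tau> \<Longrightarrow> decorated \<tau>"
  then show "bracket1_gen g h \<in> \<V>"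
    by (cases g; cases h)
      (auto simp: plant_lowered_def subspace_0 subspace_\<V> intro!: subspace_neg in_\<V>_Planted)
qed

section \<open>Identities for the bracket on generators\<close>

lemma bracket1_gen_skew: "bracket1_gen g h = - bracket1_gen h g"
  by (cases g; cases h) simp_all

lemma lower_plant_lowered_commute:
  "lin_ext (bracket1_gen (X i)) (plant_lowered a j \<tau>) =
     lin_ext (bracket1_gen (X j)) (plant_lowered a i \<tau>)"
proof -
  have "axis j 1 \<le> a \<and> axis i 1 \<le> a - axis j 1 \<longleftrightarrow> axis i 1 \<le> a \<and> axis j 1 \<le> a - axis i 1"
    by (simp add: axis_le_iff) (auto simp: axis_def)
  moreover have "a - axis j 1 - axis i 1 = a - axis i 1 - axis j 1"
    by (simp add: vec_eq_iff add.commute)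
  ultimately show ?thesis
    by (auto simp: plant_lowered_def)
qed

text \<open>Two planted arguments give only zero terms; with one planted tree and two monomials, the
  two lowerings of its edge commute.\<close>

lemma bracket1_jacobi_basis:
  "bracket1 (basis_vec f) (bracket1 (basis_vec g) (basis_vec h))
     + bracket1 (basis_vec g) (bracket1 (basis_vec h) (basis_vec f))
     + bracket1 (basis_vec h) (bracket1 (basis_vec f) (basis_vec g)) = 0"
proof -
  have planted: "lin_ext (bracket1_gen (Planted b \<sigma>)) (plant_lowered a i \<tau>) = 0" for a b i \<sigma> \<tau>
    by (simp add: plant_lowered_def)
  show ?thesis
    unfolding bracket1_def bilin_ext_basis_vec lin_ext_basis_vec
    by (cases f; cases g; cases h) (simp_all add: planted lower_plant_lowered_commute)
qed

text \<open>Lowering changes the planting edge while the product acts above it, so the two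
  commute.\<close>

lemma interp_tri_plant_lowered:
  "lin_ext (interp_tri_gen \<kappa> g) (plant_lowered a i \<tau>) =
     lin_ext (\<lambda>\<tau>'. plant_lowered a i \<tau>') (on_nodes (gen_op \<kappa> g) \<tau>)"
  by (simp add: plant_lowered_def plant_def)

lemma interp_tri_derivation:
  "lin_ext (interp_tri_gen \<kappa> f) (bracket1_gen g h) =
     lin_ext (\<lambda>k. bracket1_gen k h) (interp_tri_gen \<kappa> f g) + lin_ext (bracket1_gen g) (interp_tri_gen \<kappa> f h)"
proof -
  \<comment> \<open>Serves the case of a monomial followed by a planted tree, where the bracket
    carries a sign.\<close>
  have neg: "lin_ext (\<lambda>b. - p b) u = - lin_ext p u" for p :: "'a tree \<Rightarrow> 'a gen \<Rightarrow>\<^sub>0 real" and u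
    using lin_ext_fun_diff[of "\<lambda>_. 0" p u] by simp
  show ?thesis
    by (cases g; cases h) (simp_all add: interp_tri_plant_lowered plant_def neg)
qed

text \<open>The Jacobi identity and the derivation rule are homogeneous in the bracket, so scaling
  preserves them; in the action identity the factor \<kappa> must match the weights of the
  product.\<close>

theorem post_lie_algebra_interp_tri:
  "post_lie_algebra \<V> (\<lambda>u v. \<kappa> *\<^sub>R bracket1 u v) (bilin_ext (interp_tri_gen \<kappa>))"
proof (rule post_lie_algebra_on_basis)
  note bilin = bilinear_bilin_ext[of bracket1_gen, folded bracket1_def]
  show "bilinear (\<lambda>u v. \<kappa> *\<^sub>R bracket1 u v)"
    using bilin by (auto simp: bilinear_def intro!: linear_compose_scale_right)
  show "bilinear (bilin_ext (interp_tri_gen \<kappa>))"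
    by (rule bilinear_bilin_ext)
  show "subspace \<V>"
    by (rule subspace_\<V>)
  show "\<kappa> *\<^sub>R bracket1 x y \<in> \<V>" if "x \<in> \<V>" "y \<in> \<V>" for x y :: "'a gen \<Rightarrow>\<^sub>0 real"
    using that by (intro subspace_scale subspace_\<V> bracket1_in_\<V>)
  show "bilin_ext (interp_tri_gen \<kappa>) x y \<in> \<V>" if "x \<in> \<V>" "y \<in> \<V>" for x y :: "'a gen \<Rightarrow>\<^sub>0 real"
    using that by (rule interp_tri_in_\<V>)
  fix f g h :: "'a gen"
  show "\<kappa> *\<^sub>R bracket1 (basis_vec f) (basis_vec g) = - (\<kappa> *\<^sub>R bracket1 (basis_vec g) (basis_vec f))"
    by (simp add: bracket1_def bracket1_gen_skew[of f g])
  show "\<kappa> *\<^sub>R bracket1 (basis_vec f) (\<kappa> *\<^sub>R bracket1 (basis_vec g) (basis_vec h))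
      + \<kappa> *\<^sub>R bracket1 (basis_vec g) (\<kappa> *\<^sub>R bracket1 (basis_vec h) (basis_vec f))
      + \<kappa> *\<^sub>R bracket1 (basis_vec h) (\<kappa> *\<^sub>R bracket1 (basis_vec f) (basis_vec g)) = 0"
    using bracket1_jacobi_basis[of f g h]
    by (simp add: bilinear_rmul[OF bilin] flip: scaleR_add_right)
  show "bilin_ext (interp_tri_gen \<kappa>) (basis_vec f) (\<kappa> *\<^sub>R bracket1 (basis_vec g) (basis_vec h)) =
      \<kappa> *\<^sub>R bracket1 (bilin_ext (interp_tri_gen \<kappa>) (basis_vec f) (basis_vec g)) (basis_vec h)
      + \<kappa> *\<^sub>R bracket1 (basis_vec g) (bilin_ext (interp_tri_gen \<kappa>) (basis_vec f) (basis_vec h))"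
    by (simp add: bracket1_def interp_tri_derivation scaleR_add_right)
  show "bilin_ext (interp_tri_gen \<kappa>) (\<kappa> *\<^sub>R bracket1 (basis_vec f) (basis_vec g)
        + bilin_ext (interp_tri_gen \<kappa>) (basis_vec f) (basis_vec g)
        - bilin_ext (interp_tri_gen \<kappa>) (basis_vec g) (basis_vec f)) (basis_vec h) =
      bilin_ext (interp_tri_gen \<kappa>) (basis_vec f) (bilin_ext (interp_tri_gen \<kappa>) (basis_vec g) (basis_vec h))
      - bilin_ext (interp_tri_gen \<kappa>) (basis_vec g) (bilin_ext (interp_tri_gen \<kappa>) (basis_vec f) (basis_vec h))"
    using interp_tri_action[of \<kappa> h f g] by (simp add: bracket1_def)
qed

theorem theorem4p6:
  shows "post_lie_deformation (\<V> :: ('i::finite gen \<Rightarrow>\<^sub>0 real) set) tri bracket1 hat_tri"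
proof -
  let ?V = "\<V> :: ('i gen \<Rightarrow>\<^sub>0 real) set"
  have pre: "pre_lie_algebra ?V tri"
    using post_lie_algebra_interp_tri[of 0] by (simp add: pre_lie_algebra_def tri_eq)
  have post: "post_lie_algebra ?V bracket1 hat_tri"
    using post_lie_algebra_interp_tri[of 1] by (simp add: hat_tri_eq)
  then have bracket: "bilinear_on ?V bracket1" "alternating_on ?V bracket1"
    unfolding post_lie_algebra_def lie_algebra_def by blast+
  have "bilinear_on ?V tri" "bilinear_on ?V hat_tri"
    using pre post by (auto simp: pre_lie_algebra_def post_lie_algebra_def post_lie_algebra_axioms_def)
  \<comment> \<open>The undeformed bracket is zero, so \<pi> is the whole bracket and \<omega> the
    difference of the products.\<close>
  then have "bilinear_on ?V (\<lambda>u v. hat_tri u v - tri u v)"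
    by (auto simp: bilinear_on_def subspace_\<V> subspace_diff scaleR_diff_right)
  with pre post bracket show ?thesis
    unfolding post_lie_deformation_def
    by (intro conjI exI[of _ bracket1] exI[of _ "\<lambda>u v. hat_tri u v - tri u v"]) auto
qed

end
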